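(* Let $M\in\mathbb{C}^{p\times p}$ be nonsingular and let $\mathcal{A}\in\mathbb{C}^{m\times m\times p}$ have tubal index $k$. Then for every integer $l\ge k$, $$\mathcal{A}^{\mathrm{cep}}=\mathcal{A}^{\mathrm D}*_M\mathcal{A}^{l}*_M(\mathcal{A}^{l})^{\dagger}.$$
   Context: Transform: for $\mathcal{A}\in\mathbb{C}^{m\times n\times p}$, $\tilde{\mathcal{A}}=\mathcal{A}\times_3 M\in\mathbb{C}^{m\times n\times p}$ is given by $(\tilde{\mathcal{A}})_{ijk}=\sum_{s=1}^p(\mathcal{A})_{ijs}M_{ks}$, and $\tilde{\mathcal{A}}^{(i)}=\tilde{\mathcal{A}}(:,:,i)$ is its $i$th frontal slice. Since $M$ is nonsingular, $\mathcal{A}\mapsto\tilde{\mathcal{A}}$ is a bijection. $M$-product: for $\mathcal{A}\in\mathbb{C}^{m\times n\times p}$, $\mathcal{B}\in\mathbb{C}^{n\times q\times p}$, $\mathcal{A}*_M\mathcal{B}$ is the unique $\mathcal{C}\in\mathbb{C}^{m\times q\times p}$ with $\tilde{\mathcal{C}}^{(i)}=\tilde{\mathcal{A}}^{(i)}\tilde{\mathcal{B}}^{(i)}$, $i=1,\dots,p$. The identity tensor $\mathcal{I}$ has $\tilde{\mathcal{I}}^{(i)}=I_m$ for all $i$; powers are taken with respect to $*_M$, with $\mathcal{A}^0=\mathcal{I}$. The conjugate transpose $\mathcal{A}^*$ is the tensor whose transform has $i$th frontal slice $(\tilde{\mathcal{A}}^{(i)})^{*}$ (matrix conjugate transpose).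 Tubal index of $\mathcal{A}\in\mathbb{C}^{m\times m\times p}$: $k=\max_{1\le i\le p}\mathrm{ind}(\tilde{\mathcal{A}}^{(i)})$, where $\mathrm{ind}(A)$ is the least integer $k\ge 0$ with $\mathrm{rank}(A^k)=\mathrm{rank}(A^{k+1})$. Drazin inverse: for $\mathcal{A}$ of tubal index $k$, $\mathcal{A}^{\mathrm D}$ is the unique $\mathcal{X}\in\mathbb{C}^{m\times m\times p}$ with $\mathcal{X}*_M\mathcal{A}*_M\mathcal{X}=\mathcal{X}$, $\mathcal{A}*_M\mathcal{X}=\mathcal{X}*_M\mathcal{A}$ and $\mathcal{X}*_M\mathcal{A}^{k+1}=\mathcal{A}^k$. Moore–Penrose inverse: $\mathcal{A}^\dagger$ is the unique $\mathcal{X}$ with $\mathcal{A}*_M\mathcal{X}*_M\mathcal{A}=\mathcal{A}$, $\mathcal{X}*_M\mathcal{A}*_M\mathcal{X}=\mathcal{X}$, $(\mathcal{A}*_M\mathcal{X})^*=\mathcal{A}*_M\mathcal{X}$, $(\mathcal{X}*_M\mathcal{A})^*=\mathcal{X}*_M\mathcal{A}$. Core-EP inverse: for $\mathcal{A}$ of tubal index $k$, $\mathcal{A}^{\mathrm{cep}}$ is the tensor $\mathcal{X}\in\mathbb{C}^{m\times m\times p}$ satisfying $\mathcal{X}*_M\mathcal{A}^{k+1}=\mathcal{A}^k$, $\mathcal{A}*_M\mathcal{X}^2=\mathcal{X}$ and $(\mathcal{A}*_M\mathcal{X})^*=\mathcal{A}*_M\mathcal{X}$. *)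

theory Defs
  imports "HOL-Analysis.Analysis"
begin

text \<open>
  A tensor in \<open>C^{m \<times> n \<times> p}\<close> has its entry \<open>(i, j, k)\<close> at \<open>A $ i $ j $ k\<close>; as everywhere in
  \<open>HOL-Analysis\<close>, the dimensions are the cardinalities of finite index types.
\<close>

type_synonym ('m, 'n, 'p) tensor = "((complex ^ 'p) ^ 'n) ^ 'm"

definition frontal_slice :: "('m::finite, 'n::finite, 'p::finite) tensor \<Rightarrow> 'p \<Rightarrow> complex ^ 'n ^ 'm"
  where "frontal_slice A k = (\<chi> i j. A $ i $ j $ k)"

definition transform ::
    "complex ^ 'p ^ 'p \<Rightarrow> ('m::finite, 'n::finite, 'p::finite) tensor \<Rightarrow> ('m, 'n, 'p) tensor"
  where "transform M A = (\<chi> i j k. \<Sum>s\<in>UNIV. A $ i $ j $ s * M $ k $ s)"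

abbreviation tslice ::
    "complex ^ 'p ^ 'p \<Rightarrow> ('m::finite, 'n::finite, 'p::finite) tensor \<Rightarrow> 'p \<Rightarrow> complex ^ 'n ^ 'm"
  where "tslice M A i \<equiv> frontal_slice (transform M A) i"

text \<open>
  The instance of \<open>^\<close> on vectors is componentwise, so matrix powers are defined here from \<open>**\<close>.
\<close>

primrec matrix_power :: "complex ^ 'm ^ 'm \<Rightarrow> nat \<Rightarrow> complex ^ 'm ^ 'm" where
  "matrix_power A 0 = mat 1"
| "matrix_power A (Suc n) = A ** matrix_power A n"

definition conj_transpose :: "complex ^ 'n ^ 'm \<Rightarrow> complex ^ 'm ^ 'n"
  where "conj_transpose A = (\<chi> i j. cnj (A $ j $ i))"

definition matrix_index :: "complex ^ 'm ^ 'm \<Rightarrow> nat"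
  where "matrix_index A = (LEAST k. rank (matrix_power A k) = rank (matrix_power A (k + 1)))"

text \<open>
  The following definite descriptions are meaningful for invertible \<open>M\<close>, since then a tensor
  is determined by the frontal slices of its transform and these can be prescribed arbitrarily:
  see \<open>ex1_tensor_tslice\<close> below.
\<close>

definition mprod ::
    "('m::finite, 'n::finite, 'p::finite) tensor \<Rightarrow> complex ^ 'p ^ 'p \<Rightarrow> ('n, 'q::finite, 'p) tensor
      \<Rightarrow> ('m, 'q, 'p) tensor"  ("(_ \<star>\<^bsub>_\<^esub>/ _)" [70, 0, 71] 70)
  where "A \<star>\<^bsub>M\<^esub> B = (THE C. \<forall>i. tslice M C i = tslice M A i ** tslice M B i)"

definition identity_tensor :: "complex ^ 'p ^ 'p \<Rightarrow> ('m::finite, 'm, 'p::finite) tensor"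
  where "identity_tensor M = (THE I. \<forall>i. tslice M I i = mat 1)"

primrec mpower ::
    "complex ^ 'p ^ 'p \<Rightarrow> ('m::finite, 'm, 'p::finite) tensor \<Rightarrow> nat \<Rightarrow> ('m, 'm, 'p) tensor" where
  "mpower M A 0 = identity_tensor M"
| "mpower M A (Suc n) = A \<star>\<^bsub>M\<^esub> mpower M A n"

definition tensor_conj_transpose ::
    "complex ^ 'p ^ 'p \<Rightarrow> ('m::finite, 'n::finite, 'p::finite) tensor \<Rightarrow> ('n, 'm, 'p) tensor"
  where "tensor_conj_transpose M A = (THE B. \<forall>i. tslice M B i = conj_transpose (tslice M A i))"

definition tubal_index :: "complex ^ 'p ^ 'p \<Rightarrow> ('m::finite, 'm, 'p::finite) tensor \<Rightarrow> nat"
  where "tubal_index M A = Max (range (\<lambda>i. matrix_index (tslice M A i)))"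

definition drazin_inverse ::
    "complex ^ 'p ^ 'p \<Rightarrow> ('m::finite, 'm, 'p::finite) tensor \<Rightarrow> ('m, 'm, 'p) tensor"
  where "drazin_inverse M A =
    (THE X. X \<star>\<^bsub>M\<^esub> A \<star>\<^bsub>M\<^esub> X = X \<and>
            A \<star>\<^bsub>M\<^esub> X = X \<star>\<^bsub>M\<^esub> A \<and>
            X \<star>\<^bsub>M\<^esub> mpower M A (tubal_index M A + 1) = mpower M A (tubal_index M A))"

definition moore_penrose_inverse ::
    "complex ^ 'p ^ 'p \<Rightarrow> ('m::finite, 'n::finite, 'p::finite) tensor \<Rightarrow> ('n, 'm, 'p) tensor"
  where "moore_penrose_inverse M A =
    (THE X. A \<star>\<^bsub>M\<^esub> X \<star>\<^bsub>M\<^esub> A = A \<and>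
            X \<star>\<^bsub>M\<^esub> A \<star>\<^bsub>M\<^esub> X = X \<and>
            tensor_conj_transpose M (A \<star>\<^bsub>M\<^esub> X) = A \<star>\<^bsub>M\<^esub> X \<and>
            tensor_conj_transpose M (X \<star>\<^bsub>M\<^esub> A) = X \<star>\<^bsub>M\<^esub> A)"

definition core_EP_inverse ::
    "complex ^ 'p ^ 'p \<Rightarrow> ('m::finite, 'm, 'p::finite) tensor \<Rightarrow> ('m, 'm, 'p) tensor"
  where "core_EP_inverse M A =
    (THE X. X \<star>\<^bsub>M\<^esub> mpower M A (tubal_index M A + 1) = mpower M A (tubal_index M A) \<and>
            A \<star>\<^bsub>M\<^esub> mpower M X 2 = X \<and>
            tensor_conj_transpose M (A \<star>\<^bsub>M\<^esub> X) = A \<star>\<^bsub>M\<^esub> X)"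

lemma transform_nth: "transform M A $ i $ j = M *v (A $ i $ j)"
  by (simp add: transform_def vec_eq_iff matrix_vector_mult_def mult.commute)

lemma ex1_tensor_tslice:
  fixes M :: "complex ^ 'p ^ 'p" and S :: "'p::finite \<Rightarrow> complex ^ 'n ^ 'm"
  assumes "invertible M"
  shows "\<exists>!C :: ('m::finite, 'n::finite, 'p) tensor. \<forall>i. tslice M C i = S i"
proof -
  obtain N where N: "M ** N = mat 1" "N ** M = mat 1"
    using assms by (auto simp: invertible_def)
  show ?thesis
  proof (rule ex1I)
    show "\<forall>k. tslice M (\<chi> i j. N *v (\<chi> k. S k $ i $ j)) k = S k"
      by (simp add: frontal_slice_def vec_eq_iff transform_nth matrix_vector_mul_assoc N)
  next
    fix C :: "('m, 'n, 'p) tensor"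
    assume C: "\<forall>k. tslice M C k = S k"
    have "N *v (M *v (C $ i $ j)) = N *v (\<chi> k. S k $ i $ j)" for i j
    proof -
      have "M *v (C $ i $ j) = (\<chi> k. S k $ i $ j)"
        using C by (simp add: vec_eq_iff frontal_slice_def transform_nth)
      then show ?thesis by simp
    qed
    then show "C = (\<chi> i j. N *v (\<chi> k. S k $ i $ j))"
      by (simp add: vec_eq_iff matrix_vector_mul_assoc N)
  qed
qed

end

theory Submission
  imports Defs
begin

text \<open>
  Tensors of format \<open>m \<times> m \<times> p\<close> under \<open>\<star>\<^bsub>M\<^esub>\<close> and the conjugate transpose form a monoid with
  involution: for invertible \<open>M\<close>, passing to the slices of the transform identifies it with
  the \<open>p\<close>-fold product of the matrix monoid. The representation holds in every monoid
  with involution. If \<open>d\<close> is the Drazin inverse of \<open>a\<close> and \<open>g\<close> the Moore-Penrose inverse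
  of \<open>e = a\<^sup>l\<close>, then \<open>e g\<close> is the orthogonal projection onto the range of \<open>a\<^sup>l\<close>, which for
  \<open>l \<ge> k\<close> is also the range of \<open>a\<^sup>k\<close>; so \<open>e g\<close> fixes \<open>a\<^sup>k\<close> and \<open>e\<close>. Since \<open>a d e = e\<close>, the
  element \<open>x = d e g\<close> satisfies \<open>a x = e g\<close>, which is self-adjoint, and the other two equations
  of the core-EP inverse follow (lemma \<open>core_EP_inverse_from_Drazin\<close>).

  The three inverses are definite descriptions, so each must also be shown to exist and to be
  unique. Uniqueness is again pure monoid algebra. For existence, with \<open>S\<close> the whole monoid,
  two solvability conditions suffice: \<open>a\<^sup>k \<in> a\<^sup>k\<^sup>+\<^sup>1 S \<inter> S a\<^sup>k\<^sup>+\<^sup>1\<close> yields a Drazin inverse of \<open>a\<close>, and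
  \<open>b \<in> S b\<^sup>* b \<inter> b b\<^sup>* S\<close> yields a Moore-Penrose inverse of \<open>b\<close>. Both can be checked slice by slice. A
  matrix factors through another one on the left or right as soon as the kernels or the ranges
  are nested. For the powers this nesting is what stationary ranks express; for
  \<open>b\<^sup>* b\<close> and \<open>b\<close> it holds because the standard inner product is definite.
  The core-EP inverse exists because the formula provides one.
\<close>

section \<open>Generalized inverses in a monoid with involution\<close>

class star_monoid = monoid_mult +
  fixes star :: "'a \<Rightarrow> 'a"
  assumes star_star: "star (star a) = a"
    and star_mult: "star (a * b) = star b * star a"
begin

definition is_Drazin_inverse :: "nat \<Rightarrow> 'a \<Rightarrow> 'a \<Rightarrow> bool"
  where "is_Drazin_inverse k a x \<longleftrightarrow>
    x * a * x = x \<and> a * x = x * a \<and> x * a ^ (k + 1) = a ^ k"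

definition is_Moore_Penrose_inverse :: "'a \<Rightarrow> 'a \<Rightarrow> bool"
  where "is_Moore_Penrose_inverse a x \<longleftrightarrow>
    a * x * a = a \<and> x * a * x = x \<and> star (a * x) = a * x \<and> star (x * a) = x * a"

definition is_core_EP_inverse :: "nat \<Rightarrow> 'a \<Rightarrow> 'a \<Rightarrow> bool"
  where "is_core_EP_inverse k a x \<longleftrightarrow>
    x * a ^ (k + 1) = a ^ k \<and> a * x ^ 2 = x \<and> star (a * x) = a * x"

text \<open>
  An inverse that lowers \<open>a\<^sup>k\<^sup>+\<^sup>1\<close> to \<open>a\<^sup>k\<close> also lowers all higher powers.
\<close>

lemma lowering_power:
  assumes "x * a ^ (k + 1) = a ^ k" and "k \<le> l"
  shows "x * a ^ (l + 1) = a ^ l"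
proof -
  obtain j where l: "l = k + j"
    using assms(2) le_Suc_ex by blast
  have "x * a ^ (l + 1) = x * (a ^ (k + 1) * a ^ j)"
    unfolding l by (simp only: power_add[symmetric] ac_simps)
  also have "\<dots> = a ^ k * a ^ j"
    using assms(1) by (simp only: mult.assoc[symmetric])
  finally show ?thesis
    by (simp add: l power_add)
qed

lemma lowering_power_iterate:
  assumes "x * a ^ (k + 1) = a ^ k"
  shows "x ^ j * a ^ (k + j) = a ^ k"
proof (induction j)
  case (Suc j)
  have "x ^ Suc j * a ^ (k + Suc j) = x ^ j * (x * a ^ ((k + j) + 1))"
    by (simp add: power_Suc2 mult.assoc del: power_Suc)
  also have "\<dots> = x ^ j * a ^ (k + j)"
    using lowering_power[OF assms, of "k + j"] by simp
  finally show ?case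
    using Suc by simp
qed simp

subsection \<open>Drazin inverse\<close>

text \<open>
  In \<open>x = x\<^sup>k\<^sup>+\<^sup>1 a\<^sup>k\<close> and \<open>y = a\<^sup>k y\<^sup>k\<^sup>+\<^sup>1\<close> the power of \<open>a\<close> can be rewritten with the other
  inverse; both \<open>x\<close> and \<open>y\<close> thereby become \<open>x a y\<close>.
\<close>

lemma Drazin_inverse_unique:
  assumes "is_Drazin_inverse k a x" and "is_Drazin_inverse k a y"
  shows "x = y"
proof -
  have x: "x * a * x = x" "a * x = x * a" "x * a ^ (k + 1) = a ^ k"
    and y: "y * a * y = y" "a * y = y * a" "y * a ^ (k + 1) = a ^ k"
    using assms by (auto simp: is_Drazin_inverse_def)
  have left: "x ^ Suc n * a ^ n = x" for n
  proof (induction n)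
    case (Suc n)
    have "x ^ Suc (Suc n) * a ^ Suc n = x * (x ^ Suc n * a ^ n) * a"
      by (simp only: power_Suc2[of a] power_Suc[of x "Suc n"] mult.assoc)
    also have "\<dots> = x * a * x"
      using Suc x(2) by (simp add: mult.assoc)
    finally show ?case
      using x(1) by simp
  qed simp
  have right: "a ^ n * y ^ Suc n = y" for n
  proof (induction n)
    case (Suc n)
    have "a ^ Suc n * y ^ Suc (Suc n) = a * (a ^ n * y ^ Suc n) * y"
      by (simp only: power_Suc[of a] power_Suc2[of y "Suc n"] mult.assoc)
    also have "\<dots> = y * a * y"
      using Suc y(2) by simp
    finally show ?case
      using y(1) by simp
  qed simp
  have "a ^ (k + 1) * y = a ^ k"
    using power_commuting_commutes[of a y "k + 1"] y(2,3) by simp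
  then have "x = x ^ Suc k * (a ^ (k + 1) * y)"
    using left[of k] by simp
  also have "\<dots> = (x ^ Suc k * a ^ k) * a * y"
    by (simp only: power_Suc2[of a] mult.assoc Suc_eq_plus1[symmetric])
  also have "\<dots> = x * a * y"
    using left by simp
  finally have "x = x * a * y" .
  moreover have "y = (x * a ^ (k + 1)) * y ^ Suc k"
    using right[of k] x(3) by simp
  then have "y = x * a * (a ^ k * y ^ Suc k)"
    by (simp only: power_Suc[of a] mult.assoc Suc_eq_plus1[symmetric])
  then have "y = x * a * y"
    using right by simp
  ultimately show ?thesis
    by simp
qed

text \<open>
  The one-sided lowering elements \<open>y\<close> and \<open>z\<close> need not commute with \<open>a\<close>, but
  \<open>a\<^sup>k y = z a\<^sup>k\<close>. Hence \<open>a\<^sup>k y\<^sup>k\<^sup>+\<^sup>1 = z\<^sup>k\<^sup>+\<^sup>1 a\<^sup>k\<close>, and this element can be computed with from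
  either side.
\<close>

lemma Drazin_inverse_exists:
  assumes y: "a ^ (k + 1) * y = a ^ k" and z: "z * a ^ (k + 1) = a ^ k"
  shows "\<exists>x. is_Drazin_inverse k a x"
proof -
  have "a ^ k * y = z * a ^ (k + 1) * y"
    using z by simp
  also have "\<dots> = z * a ^ k"
    using y by (simp only: mult.assoc)
  finally have yz: "a ^ k * y = z * a ^ k" .
  have swap: "a ^ k * y ^ j = z ^ j * a ^ k" for j
  proof (induction j)
    case (Suc j)
    have "a ^ k * y ^ Suc j = (a ^ k * y) * y ^ j"
      by (simp only: power_Suc mult.assoc)
    also have "\<dots> = z * (a ^ k * y ^ j)"
      by (simp only: yz mult.assoc)
    also have "\<dots> = z ^ Suc j * a ^ k"
      by (simp only: Suc power_Suc mult.assoc)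
    finally show ?case .
  qed simp
  define x where "x = a ^ k * y ^ Suc k"
  have x': "x = z ^ Suc k * a ^ k"
    unfolding x_def by (rule swap)
  have "a * x = (a ^ (k + 1) * y) * y ^ k"
    by (simp only: x_def power_Suc mult.assoc Suc_eq_plus1[symmetric])
  then have ax: "a * x = a ^ k * y ^ k"
    using y by simp
  have "x * a = z ^ k * (z * a ^ (k + 1))"
    by (simp only: x' power_Suc2 mult.assoc Suc_eq_plus1[symmetric])
  then have xa: "x * a = z ^ k * a ^ k"
    using z by simp
  have "x * a * x = (z ^ k * a ^ (k + k)) * y ^ Suc k"
    by (subst xa) (simp only: x_def power_add mult.assoc)
  then have "x * a * x = x"
    using lowering_power_iterate[OF z, of k] x_def by simp
  moreover have "x * a ^ (k + 1) = z ^ Suc k * a ^ (k + Suc k)"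
    by (simp only: x' power_add mult.assoc Suc_eq_plus1)
  then have "x * a ^ (k + 1) = a ^ k"
    using lowering_power_iterate[OF z, of "Suc k"] by simp
  moreover have "a * x = x * a"
    using ax xa swap by simp
  ultimately show ?thesis
    unfolding is_Drazin_inverse_def by blast
qed

subsection \<open>Moore-Penrose inverse\<close>

text \<open>
  Uniqueness of the orthogonal projection onto a given range: \<open>p q = q\<close> and \<open>q p = p\<close> say that
  the ranges agree, and \<open>star\<close> turns \<open>p q = q\<close> into \<open>q p = q\<close>.
\<close>

lemma self_adjoint_eqI:
  assumes "star p = p" "star q = q" "p * q = q" "q * p = p"
  shows "p = q"
  by (metis assms star_mult)

lemma Moore_Penrose_inverse_unique:
  assumes "is_Moore_Penrose_inverse a x" and "is_Moore_Penrose_inverse a y"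
  shows "x = y"
proof -
  have x: "a * x * a = a" "x * a * x = x" "star (a * x) = a * x" "star (x * a) = x * a"
    and y: "a * y * a = a" "y * a * y = y" "star (a * y) = a * y" "star (y * a) = y * a"
    using assms by (auto simp: is_Moore_Penrose_inverse_def)
  have "a * x = a * y"
    by (rule self_adjoint_eqI[OF x(3) y(3)]) (simp_all only: mult.assoc[symmetric] x(1) y(1))
  \<comment> \<open>What \<open>x a\<close> and \<open>y a\<close> visibly share is the kernel instead of the range, so here the left
    factor survives in their products.\<close>
  moreover have "x * a = y * a"
  proof -
    have "(x * a) * (y * a) = x * a" "(y * a) * (x * a) = y * a"
      using x(1) y(1) by (metis mult.assoc)+
    then show ?thesis
      using x(4) y(4) star_mult by metis
  qed
  ultimately show ?thesis
    using x(2) y(2) by (metis mult.assoc)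
qed

text \<open>
  The equation \<open>w a\<^sup>* a = a\<close> makes \<open>w\<^sup>*\<close> an inner inverse with \<open>a w\<^sup>*\<close> self-adjoint, and
  \<open>a a\<^sup>* v = a\<close> makes \<open>v\<^sup>*\<close> one with \<open>v\<^sup>* a\<close> self-adjoint; \<open>v\<^sup>* a w\<^sup>*\<close> combines both.
\<close>

lemma Moore_Penrose_inverse_exists:
  assumes w: "w * star a * a = a" and v: "a * star a * v = a"
  shows "\<exists>x. is_Moore_Penrose_inverse a x"
proof -
  define p where "p = star w"
  define q where "q = star v"
  have sp: "star p = w" and sq: "star q = v"
    by (simp_all add: p_def q_def star_star)
  have "star a = star (w * star a * a)"
    using w by simp
  then have a1: "star a = star a * a * p"
    by (simp add: star_mult star_star p_def mult.assoc)
  have "star a = star (a * star a * v)"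
    using v by simp
  then have a2: "star a = q * a * star a"
    by (simp add: star_mult star_star q_def mult.assoc)
  have "a * p = w * star a * a * p"
    using w by simp
  also have "\<dots> = w * star a"
    using a1 by (simp add: mult.assoc)
  finally have ap: "a * p = w * star a" .
  have "q * a = q * (a * star a * v)"
    using v by simp
  also have "\<dots> = star a * v"
    using a2 by (metis mult.assoc)
  finally have qa: "q * a = star a * v" .
  have apa: "a * p * a = a"
    using ap w by simp
  have aqa: "a * q * a = a"
    using qa v by (simp add: mult.assoc)
  define x where "x = q * a * p"
  have ax: "a * x = a * p"
    using aqa by (simp add: x_def mult.assoc[symmetric])
  have xa: "x * a = q * a"
    using apa by (simp add: x_def mult.assoc)
  have "a * x * a = a"
    using ax apa by simp
  moreover have "x * a * x = x"
    using xa ax by (metis mult.assoc x_def)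
  moreover have "star (a * x) = a * x"
    using ap ax sp star_mult[of a p] by simp
  moreover have "star (x * a) = x * a"
    using qa xa sq star_mult[of q a] by simp
  ultimately show ?thesis
    unfolding is_Moore_Penrose_inverse_def by blast
qed

subsection \<open>Core-EP inverse\<close>

text \<open>
  If \<open>x\<close> is a core-EP inverse, then \<open>a x\<close> is the orthogonal projection onto the range of \<open>a\<^sup>k\<^sup>+\<^sup>1\<close>,
  hence determined by \<open>a\<close>; and \<open>x = x (a x)\<close> is recovered from it because \<open>x\<close>
  acts as lowering on that range.
\<close>

lemma core_EP_inverse_unique:
  assumes "is_core_EP_inverse k a x" and "is_core_EP_inverse k a y"
  shows "x = y"
proof -
  have expand: "a ^ n * u ^ Suc n = u" if "is_core_EP_inverse k a u" for u n
  proof (induction n)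
    case (Suc n)
    have u: "a * u ^ 2 = u"
      using that by (simp add: is_core_EP_inverse_def)
    have "a ^ Suc n * u ^ Suc (Suc n) = a ^ n * (a * u ^ 2) * u ^ n"
      by (simp only: power_Suc2[of a] power_Suc[of u] power2_eq_square mult.assoc)
    also have "\<dots> = a ^ n * u ^ Suc n"
      by (simp only: u power_Suc mult.assoc)
    also have "\<dots> = u"
      by (rule Suc)
    finally show ?case .
  qed simp
  have proj: "a * u = a ^ (k + 1) * u ^ (k + 1)" if "is_core_EP_inverse k a u" for u
    by (simp only: Suc_eq_plus1[symmetric] power_Suc[of a] mult.assoc expand[OF that])
  have fix_range: "a * u * a ^ (k + 1) = a ^ (k + 1)" if "is_core_EP_inverse k a u" for u
  proof -
    have "u * a ^ (k + 1) = a ^ k"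
      using that by (simp add: is_core_EP_inverse_def)
    then show ?thesis
      by (simp add: mult.assoc)
  qed
  have absorb: "(a * u) * (a * t) = a * t"
    if "is_core_EP_inverse k a u" "is_core_EP_inverse k a t" for u t
  proof -
    have "(a * u) * (a * t) = (a * u * a ^ (k + 1)) * t ^ (k + 1)"
      by (simp only: proj[OF that(2)] mult.assoc)
    then show ?thesis
      by (simp only: fix_range[OF that(1)] proj[OF that(2)])
  qed
  have eq: "a * x = a * y"
  proof (rule self_adjoint_eqI)
    show "star (a * x) = a * x" "star (a * y) = a * y"
      using assms by (simp_all add: is_core_EP_inverse_def)
  qed (use assms absorb in blast)+
  have lower: "u * (a * t) = t"
    if "is_core_EP_inverse k a u" "is_core_EP_inverse k a t" for u t
  proof -
    have "u * (a * t) = (u * a ^ (k + 1)) * t ^ (k + 1)"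
      by (simp only: proj[OF that(2)] mult.assoc)
    also have "\<dots> = a ^ k * t ^ Suc k"
      using that(1) by (simp add: is_core_EP_inverse_def)
    finally show ?thesis
      using expand[OF that(2), of k] by simp
  qed
  show ?thesis
    using lower[OF assms(1,1)] lower[OF assms] eq by metis
qed

text \<open>
  The hypothesis \<open>k \<le> l\<close> enters twice: \<open>d a\<^sup>l\<^sup>+\<^sup>1 = a\<^sup>l\<close> makes \<open>a\<close> times the proposed inverse equal to
  the projection \<open>a\<^sup>l g\<close>, and \<open>a\<^sup>k = a\<^sup>l d\<^sup>l\<^sup>-\<^sup>k\<close> puts \<open>a\<^sup>k\<close> into the range of that projection.
\<close>

lemma core_EP_inverse_from_Drazin:
  assumes d: "is_Drazin_inverse k a d" and "k \<le> l"
    and g: "is_Moore_Penrose_inverse (a ^ l) g"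
  shows "is_core_EP_inverse k a (d * a ^ l * g)"
proof -
  have ad: "a * d = d * a" and lower: "d * a ^ (k + 1) = a ^ k"
    using d by (auto simp: is_Drazin_inverse_def)
  define e where "e = a ^ l"
  have ege: "e * g * e = e" and sym: "star (e * g) = e * g"
    using g by (auto simp: is_Moore_Penrose_inverse_def e_def)
  have ed: "e * d = d * e"
    unfolding e_def using ad by (rule power_commuting_commutes)
  have ade: "a * d * e = e"
    using lowering_power[OF lower \<open>k \<le> l\<close>] ad by (simp add: e_def mult.assoc)
  have "a ^ k = d ^ (l - k) * e"
    using lowering_power_iterate[OF lower, of "l - k"] \<open>k \<le> l\<close> by (simp add: e_def)
  also have "\<dots> = e * d ^ (l - k)"
    using power_commuting_commutes[OF ed[symmetric]] by simp
  finally have ak: "a ^ k = e * d ^ (l - k)" .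
  have "e * g * a ^ k = (e * g * e) * d ^ (l - k)"
    by (simp only: ak mult.assoc)
  then have "e * g * a ^ k = a ^ k"
    by (simp only: ege ak)
  moreover have "e * g * a ^ (k + 1) = (e * g * a ^ k) * a"
    by (simp only: Suc_eq_plus1[symmetric] power_Suc2[of a] mult.assoc)
  ultimately have ega: "e * g * a ^ (k + 1) = a ^ (k + 1)"
    by (simp only: Suc_eq_plus1[symmetric] power_Suc2[of a])
  define x where "x = d * e * g"
  have ax: "a * x = e * g"
    using ade by (simp add: x_def mult.assoc[symmetric])
  have "x * a ^ (k + 1) = d * (e * g * a ^ (k + 1))"
    by (simp only: x_def mult.assoc)
  then have "x * a ^ (k + 1) = a ^ k"
    using ega lower by simp
  moreover have "a * x ^ 2 = x"
  proof -
    have "a * x ^ 2 = (a * x) * x"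
      by (simp only: power2_eq_square mult.assoc)
    also have "\<dots> = e * g * (e * d * g)"
      by (simp only: ax) (simp only: x_def ed)
    also have "\<dots> = (e * g * e) * d * g"
      by (simp only: mult.assoc)
    also have "\<dots> = x"
      by (simp only: ege ed x_def)
    finally show ?thesis .
  qed
  moreover have "star (a * x) = a * x"
    using ax sym by simp
  ultimately show ?thesis
    unfolding is_core_EP_inverse_def x_def e_def by blast
qed

end

section \<open>Solvability of matrix equations\<close>

text \<open>
  A linear right inverse of \<open>B\<close> over its range serves as \<open>G\<close>. Such an inner inverse turns every
  solvable equation \<open>C = Z B\<close> or \<open>C = B Y\<close> into an explicit identity, \<open>C = (C G) B\<close> or
  \<open>C = B (G C)\<close>.
\<close>

lemma matrix_inner_inverse:
  fixes B :: "'a::field ^ 'n ^ 'm"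
  obtains G where "B ** G ** B = B"
proof -
  obtain g where g: "Vector_Spaces.linear (*s) (*s) g" "\<And>v. B *v g (B *v v) = B *v v"
    using vec.linear_exists_right_inverse_on[OF matrix_vector_mul_linear_gen[of B] vec.subspace_UNIV]
    by auto
  have "B *v (matrix g *v (B *v v)) = B *v v" for v
    using g by (simp add: matrix_works)
  then have "B ** matrix g ** B = B"
    by (simp add: matrix_eq matrix_vector_mul_assoc[symmetric])
  then show thesis
    using that by blast
qed

lemma factor_through_kernel:
  fixes B :: "'a::field ^ 'n ^ 'm" and C :: "'a ^ 'n ^ 'q"
  assumes "\<And>x. B *v x = 0 \<Longrightarrow> C *v x = 0"
  shows "\<exists>Z. Z ** B = C"
proof -
  obtain G where G: "B ** G ** B = B"
    by (rule matrix_inner_inverse)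
  have "C *v x = (C ** G ** B) *v x" for x
  proof -
    have "B *v (x - G *v (B *v x)) = 0"
      using G by (simp add: matrix_vector_mult_diff_distrib matrix_vector_mul_assoc matrix_mul_assoc)
    then have "C *v (x - G *v (B *v x)) = 0"
      by (rule assms)
    then show ?thesis
      by (simp add: matrix_vector_mult_diff_distrib matrix_vector_mul_assoc matrix_mul_assoc)
  qed
  then have "C ** G ** B = C"
    unfolding matrix_eq by simp
  then show ?thesis ..
qed

lemma factor_through_range:
  fixes B :: "'a::field ^ 'n ^ 'm" and C :: "'a ^ 'q ^ 'm"
  assumes "range ((*v) C) \<subseteq> range ((*v) B)"
  shows "\<exists>Y. B ** Y = C"
proof -
  obtain G where G: "B ** G ** B = B"
    by (rule matrix_inner_inverse)
  have "(B ** (G ** C)) *v x = C *v x" for x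
  proof -
    obtain u where "C *v x = B *v u"
      using assms by blast
    moreover have "(B ** (G ** C)) *v x = B *v (G *v (C *v x))"
      by (simp add: matrix_vector_mul_assoc matrix_mul_assoc)
    moreover have "B *v (G *v (B *v u)) = B *v u"
      using G by (simp add: matrix_vector_mul_assoc matrix_mul_assoc)
    ultimately show ?thesis
      by simp
  qed
  then have "B ** (G ** C) = C"
    unfolding matrix_eq by simp
  then show ?thesis ..
qed

lemma rows_mult_subset:
  fixes A :: "'a::field ^ 'n ^ 'm" and B :: "'a ^ 'q ^ 'n"
  shows "rows (A ** B) \<subseteq> vec.span (rows B)"
proof
  fix v assume "v \<in> rows (A ** B)"
  then obtain i where "v = row i (A ** B)"
    by (auto simp: rows_def)
  then have "v = (\<Sum>j\<in>UNIV. A $ i $ j *s row j B)"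
    by (simp add: vec_eq_iff row_def matrix_matrix_mult_def)
  moreover have "row j B \<in> vec.span (rows B)" for j
    by (rule vec.span_base) (auto simp: rows_def)
  ultimately show "v \<in> vec.span (rows B)"
    by (simp add: vec.span_sum vec.span_scale)
qed

lemma rank_mult_le:
  fixes A :: "'a::field ^ 'n ^ 'm" and B :: "'a ^ 'q ^ 'n"
  shows "rank (A ** B) \<le> rank B"
  unfolding row_rank_def_gen
  using vec.dim_subset[OF rows_mult_subset[of A B]] by simp

text \<open>
  Equal rank makes the row spaces of \<open>A B\<close> and \<open>B\<close> equal. A vector that \<open>A B\<close> kills is
  orthogonal (without conjugation) to the rows of \<open>A B\<close>, so to their span, so to the rows of \<open>B\<close>.
\<close>

lemma rank_mult_eq_imp_kernel:
  fixes A :: "'a::field ^ 'n ^ 'm" and B :: "'a ^ 'q ^ 'n"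
  assumes "rank (A ** B) = rank B" and x: "(A ** B) *v x = 0"
  shows "B *v x = 0"
proof -
  have "vec.span (rows (A ** B)) = vec.span (rows B)"
    using vec.dim_eq_span[of "rows (A ** B)" "vec.span (rows B)"] rows_mult_subset[of A B] assms(1)
    by (simp add: row_rank_def_gen vec.span_span)
  then have rows: "row i B \<in> vec.span (rows (A ** B))" for i
    using vec.span_base[of "row i B" "rows B"] by (auto simp: rows_def)
  have "vec.subspace {v. (\<Sum>j\<in>UNIV. v $ j * x $ j) = 0}"
    by (auto simp: vec.subspace_def distrib_right sum.distrib mult.assoc sum_distrib_left[symmetric])
  moreover have "rows (A ** B) \<subseteq> {v. (\<Sum>j\<in>UNIV. v $ j * x $ j) = 0}"
    using x by (auto simp: rows_def row_def matrix_vector_mult_def vec_eq_iff)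
  ultimately have "vec.span (rows (A ** B)) \<subseteq> {v. (\<Sum>j\<in>UNIV. v $ j * x $ j) = 0}"
    by (simp add: vec.span_minimal)
  with rows have "(\<Sum>j\<in>UNIV. row i B $ j * x $ j) = 0" for i
    by blast
  then show ?thesis
    by (simp add: vec_eq_iff row_def matrix_vector_mult_def)
qed

lemma matrix_power_add: "matrix_power A (m + n) = matrix_power A m ** matrix_power A n"
  by (induction m) (simp_all add: matrix_mul_assoc)

lemma rank_matrix_index:
  fixes A :: "complex ^ 'm ^ 'm"
  shows "rank (matrix_power A (matrix_index A)) = rank (matrix_power A (matrix_index A + 1))"
proof -
  \<comment> \<open>Ranks of powers decrease, so they are stationary wherever the rank is smallest.\<close>
  obtain k where "\<forall>j. rank (matrix_power A k) \<le> rank (matrix_power A j)"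
    using ex_has_least_nat[of "\<lambda>_. True" 0 "\<lambda>j. rank (matrix_power A j)"] by auto
  then have "rank (matrix_power A k) \<le> rank (matrix_power A (k + 1))" ..
  then have "rank (matrix_power A k) = rank (matrix_power A (k + 1))"
    using rank_mult_le[of A "matrix_power A k"] by simp
  then show ?thesis
    unfolding matrix_index_def by (rule LeastI)
qed

text \<open>
  At the index \<open>i\<close>, equality of ranks gives equal kernels of \<open>A\<^sup>i\<close> and \<open>A\<^sup>i\<^sup>+\<^sup>1\<close>. So \<open>A\<close> is
  injective on the range of \<open>A\<^sup>i\<close>, and by finite dimension it maps that range onto
  itself. Higher powers are treated by multiplying the two equations with powers of \<open>A\<close>.
\<close>

lemma matrix_power_lowering:
  fixes A :: "complex ^ 'm ^ 'm"
  assumes "matrix_index A \<le> k"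
  shows "\<exists>Z. Z ** matrix_power A (k + 1) = matrix_power A k"
    and "\<exists>Y. matrix_power A (k + 1) ** Y = matrix_power A k"
proof -
  define i where "i = matrix_index A"
  define P where "P = matrix_power A i"
  have Suc_i: "matrix_power A (i + 1) = A ** P" "matrix_power A (i + 1) = P ** A"
    using matrix_power_add[of A i 1] by (simp_all add: P_def)
  have ker: "P *v x = 0" if "(A ** P) *v x = 0" for x
    using rank_mult_eq_imp_kernel[of A P x] rank_matrix_index[of A] that
    by (simp add: P_def i_def)
  obtain Z where Z: "Z ** (A ** P) = P"
    using factor_through_kernel[of "A ** P" P] ker by blast
  have R: "vec.subspace (range ((*v) P))"
    by (simp add: vec.subspace_image)
  then have span_R: "vec.span (range ((*v) P)) = range ((*v) P)"
    by simp
  have "inj_on ((*v) A) (range ((*v) P))"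
  proof (rule inj_on_inverseI[where g = "(*v) Z"])
    show "Z *v (A *v u) = u" if "u \<in> range ((*v) P)" for u
      using that Z by (auto simp: matrix_vector_mul_assoc matrix_mul_assoc)
  qed
  then have dim: "vec.dim ((*v) A ` range ((*v) P)) = vec.dim (range ((*v) P))"
    by (intro vec.dim_image_eq) (simp_all only: span_R matrix_vector_mul_linear_gen)
  have sub: "(*v) A ` range ((*v) P) \<subseteq> range ((*v) P)"
  proof -
    have "A *v (P *v x) = P *v (A *v x)" for x
      using Suc_i by (simp add: matrix_vector_mul_assoc)
    then show ?thesis
      by auto
  qed
  have "(*v) A ` range ((*v) P) = range ((*v) P)"
    by (rule vec.subspace_dim_equal) (use R dim sub in \<open>auto simp: vec.subspace_image\<close>)
  then have "range ((*v) P) \<subseteq> range ((*v) (A ** P))"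
    by (simp add: image_image matrix_vector_mul_assoc)
  then obtain Y where Y: "A ** P ** Y = P"
    using factor_through_range[of P "A ** P"] by blast
  obtain j where k: "k = i + j"
    using assms le_Suc_ex i_def by blast
  have "Z ** matrix_power A (k + 1) = Z ** matrix_power A (i + 1) ** matrix_power A j"
    unfolding matrix_mul_assoc[symmetric] matrix_power_add[symmetric] by (simp add: k)
  also have "\<dots> = matrix_power A k"
    using Z by (simp only: Suc_i(1)) (simp add: P_def k matrix_power_add)
  finally show "\<exists>Z. Z ** matrix_power A (k + 1) = matrix_power A k" ..
  have "matrix_power A (k + 1) ** Y = matrix_power A (j + (i + 1)) ** Y"
    by (simp add: k add.commute)
  also have "\<dots> = matrix_power A j ** (A ** P ** Y)"
    by (simp only: matrix_power_add[of A j "i + 1"] Suc_i(1) matrix_mul_assoc)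
  also have "\<dots> = matrix_power A k"
    using Y by (simp add: P_def k matrix_power_add[symmetric] add.commute)
  finally show "\<exists>Y. matrix_power A (k + 1) ** Y = matrix_power A k" ..
qed

lemma conj_transpose_conj_transpose: "conj_transpose (conj_transpose A) = A"
  by (simp add: conj_transpose_def vec_eq_iff)

lemma conj_transpose_mult:
  "conj_transpose (A ** B) = conj_transpose B ** conj_transpose A"
  by (simp add: conj_transpose_def vec_eq_iff matrix_matrix_mult_def mult.commute)

text \<open>
  The kernels of \<open>A\<^sup>* A\<close> and \<open>A\<close> coincide, since \<open>x\<^sup>* A\<^sup>* A x\<close> is the sum of the squared moduli of the
  entries of \<open>A x\<close>.
\<close>

lemma matrix_factor_conj_transpose:
  fixes A :: "complex ^ 'n ^ 'm"
  shows "\<exists>W. W ** (conj_transpose A ** A) = A"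
proof (rule factor_through_kernel)
  fix x assume x: "(conj_transpose A ** A) *v x = 0"
  define y where "y = A *v x"
  have y: "(\<Sum>i\<in>UNIV. cnj (A $ i $ j) * y $ i) = 0" for j
    using x by (simp add: matrix_vector_mul_assoc[symmetric] y_def[symmetric])
      (simp add: vec_eq_iff matrix_vector_mult_def conj_transpose_def)
  have cnj_y: "cnj (y $ i) = (\<Sum>j\<in>UNIV. cnj (x $ j) * cnj (A $ i $ j))" for i
    by (simp add: y_def matrix_vector_mult_def mult.commute)
  have "(\<Sum>i\<in>UNIV. cnj (y $ i) * y $ i)
      = (\<Sum>i\<in>UNIV. \<Sum>j\<in>UNIV. cnj (x $ j) * (cnj (A $ i $ j) * y $ i))"
    by (simp only: cnj_y sum_distrib_right mult.assoc)
  also have "\<dots> = (\<Sum>j\<in>UNIV. cnj (x $ j) * (\<Sum>i\<in>UNIV. cnj (A $ i $ j) * y $ i))"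
    unfolding sum_distrib_left by (rule sum.swap)
  finally have "(\<Sum>i\<in>UNIV. cnj (y $ i) * y $ i) = 0"
    using y by simp
  then have "complex_of_real (\<Sum>i\<in>UNIV. (cmod (y $ i))\<^sup>2) = 0"
    by (simp only: of_real_sum complex_norm_square mult.commute)
  then have "(\<Sum>i\<in>UNIV. (cmod (y $ i))\<^sup>2) = 0"
    by (simp only: of_real_eq_0_iff)
  then have "y = 0"
    by (simp add: sum_nonneg_eq_0_iff vec_eq_iff)
  then show "A *v x = 0"
    by (simp add: y_def)
qed

section \<open>The monoid of tensors\<close>

lemma tensor_eqI:
  assumes "invertible M" and "\<And>i. tslice M X i = tslice M Y i"
  shows "X = Y"
  using ex1_tensor_tslice[OF assms(1), of "tslice M Y"] assms(2) by blast

lemma ex_tensor_slicewise: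
  assumes "invertible M" and "\<And>i. \<exists>S. P i S"
  shows "\<exists>X. \<forall>i. P i (tslice M X i)"
  by (metis assms ex1_tensor_tslice)

lemma tslice_The:
  assumes "invertible M"
  shows "tslice M (THE C. \<forall>j. tslice M C j = S j) i = S i"
  using theI'[OF ex1_tensor_tslice[OF assms, of S]] by blast

lemma tslice_mprod:
  assumes "invertible M"
  shows "tslice M (A \<star>\<^bsub>M\<^esub> B) i = tslice M A i ** tslice M B i"
  unfolding mprod_def by (rule tslice_The[OF assms])

lemma tslice_identity_tensor:
  assumes "invertible M"
  shows "tslice M (identity_tensor M) i = mat 1"
  unfolding identity_tensor_def by (rule tslice_The[OF assms])

lemma tslice_tensor_conj_transpose:
  assumes "invertible M"
  shows "tslice M (tensor_conj_transpose M A) i = conj_transpose (tslice M A i)"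
  unfolding tensor_conj_transpose_def by (rule tslice_The[OF assms])

lemmas tslice_simps = tslice_mprod tslice_identity_tensor tslice_tensor_conj_transpose

lemma tslice_mpower:
  assumes "invertible M"
  shows "tslice M (mpower M A n) i = matrix_power (tslice M A i) n"
  using assms by (induction n) (simp_all add: tslice_simps)

lemma star_monoid_tensor:
  assumes "invertible M"
  shows "class.star_monoid (identity_tensor M) (\<lambda>X Y. X \<star>\<^bsub>M\<^esub> Y) (tensor_conj_transpose M)"
  by unfold_locales
    (rule tensor_eqI[OF assms], simp add: assms tslice_simps matrix_mul_assoc
      conj_transpose_conj_transpose conj_transpose_mult)+

lemma tensor_power_lowering:
  assumes "invertible M" and "tubal_index M A = k"
  shows "\<exists>Z. Z \<star>\<^bsub>M\<^esub> mpower M A (k + 1) = mpower M A k"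
    and "\<exists>Y. mpower M A (k + 1) \<star>\<^bsub>M\<^esub> Y = mpower M A k"
proof -
  have "matrix_index (tslice M A i) \<le> k" for i
    using assms(2) unfolding tubal_index_def by auto
  note lowering = matrix_power_lowering[OF this]
  have "\<exists>Z. \<forall>i. tslice M Z i ** matrix_power (tslice M A i) (k + 1) = matrix_power (tslice M A i) k"
    by (rule ex_tensor_slicewise[OF assms(1) lowering(1)])
  then obtain Z where "\<And>i. tslice M Z i ** matrix_power (tslice M A i) (k + 1)
      = matrix_power (tslice M A i) k"
    by blast
  then have "Z \<star>\<^bsub>M\<^esub> mpower M A (k + 1) = mpower M A k"
    by (intro tensor_eqI[OF assms(1)]) (simp only: tslice_mprod tslice_mpower assms(1))
  then show "\<exists>Z. Z \<star>\<^bsub>M\<^esub> mpower M A (k + 1) = mpower M A k" ..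
  have "\<exists>Y. \<forall>i. matrix_power (tslice M A i) (k + 1) ** tslice M Y i = matrix_power (tslice M A i) k"
    by (rule ex_tensor_slicewise[OF assms(1) lowering(2)])
  then obtain Y where "\<And>i. matrix_power (tslice M A i) (k + 1) ** tslice M Y i
      = matrix_power (tslice M A i) k"
    by blast
  then have "mpower M A (k + 1) \<star>\<^bsub>M\<^esub> Y = mpower M A k"
    by (intro tensor_eqI[OF assms(1)]) (simp only: tslice_mprod tslice_mpower assms(1))
  then show "\<exists>Y. mpower M A (k + 1) \<star>\<^bsub>M\<^esub> Y = mpower M A k" ..
qed

lemma tensor_factor_conj_transpose:
  assumes "invertible M"
  shows "\<exists>W. W \<star>\<^bsub>M\<^esub> (tensor_conj_transpose M A \<star>\<^bsub>M\<^esub> A) = A"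
proof -
  have "\<exists>W. \<forall>i. tslice M W i ** (conj_transpose (tslice M A i) ** tslice M A i) = tslice M A i"
    by (rule ex_tensor_slicewise[OF assms matrix_factor_conj_transpose])
  then obtain W where "\<And>i. tslice M W i ** (conj_transpose (tslice M A i) ** tslice M A i)
      = tslice M A i"
    by blast
  then have "W \<star>\<^bsub>M\<^esub> (tensor_conj_transpose M A \<star>\<^bsub>M\<^esub> A) = A"
    by (intro tensor_eqI[OF assms]) (simp only: tslice_simps assms)
  then show ?thesis ..
qed

section \<open>The core-EP inverse of a tensor\<close>

theorem theorem4p6:
  fixes M :: "complex ^ 'p ^ 'p"
    and A :: "('m::finite, 'm, 'p::finite) tensor"
    and k l :: nat
  assumes "invertible M"
    and "tubal_index M A = k"
    and "l \<ge> k"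
  shows "core_EP_inverse M A =
    drazin_inverse M A \<star>\<^bsub>M\<^esub> mpower M A l \<star>\<^bsub>M\<^esub> moore_penrose_inverse M (mpower M A l)"
proof -
  interpret T: star_monoid "identity_tensor M" "\<lambda>X Y :: ('m, 'm, 'p) tensor. X \<star>\<^bsub>M\<^esub> Y"
    "tensor_conj_transpose M"
    by (rule star_monoid_tensor[OF assms(1)])
  have pow: "T.power X n = mpower M X n" for X :: "('m, 'm, 'p) tensor" and n
    by (induction n) simp_all
  have "\<exists>X. T.is_Drazin_inverse k A X"
    using tensor_power_lowering[OF assms(1,2)] T.Drazin_inverse_exists[of A k, unfolded pow]
    by blast
  then obtain D where D: "T.is_Drazin_inverse k A D" ..
  have "drazin_inverse M A = (THE X. T.is_Drazin_inverse k A X)"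
    by (simp only: drazin_inverse_def T.is_Drazin_inverse_def pow assms(2))
  also have "\<dots> = D"
    using D T.Drazin_inverse_unique by blast
  finally have D_eq: "drazin_inverse M A = D" .
  define B where "B = mpower M A l"
  obtain W where W: "W \<star>\<^bsub>M\<^esub> tensor_conj_transpose M B \<star>\<^bsub>M\<^esub> B = B"
    using tensor_factor_conj_transpose[OF assms(1), of B] by (auto simp: T.mult.assoc)
  \<comment> \<open>The second factorization is the adjoint of the first one, for \<open>B\<^sup>*\<close> in place of \<open>B\<close>.\<close>
  obtain V where "V \<star>\<^bsub>M\<^esub> (B \<star>\<^bsub>M\<^esub> tensor_conj_transpose M B) = tensor_conj_transpose M B"
    using tensor_factor_conj_transpose[OF assms(1), of "tensor_conj_transpose M B"]
    by (auto simp: T.star_star)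
  from arg_cong[OF this, of "tensor_conj_transpose M"]
  have "B \<star>\<^bsub>M\<^esub> tensor_conj_transpose M B \<star>\<^bsub>M\<^esub> tensor_conj_transpose M V = B"
    by (simp add: T.star_mult T.star_star)
  then obtain G where G: "T.is_Moore_Penrose_inverse B G"
    using T.Moore_Penrose_inverse_exists[OF W] by blast
  have "moore_penrose_inverse M B = (THE X. T.is_Moore_Penrose_inverse B X)"
    by (simp only: moore_penrose_inverse_def T.is_Moore_Penrose_inverse_def)
  also have "\<dots> = G"
    using G T.Moore_Penrose_inverse_unique by blast
  finally have G_eq: "moore_penrose_inverse M B = G" .
  have C: "T.is_core_EP_inverse k A (D \<star>\<^bsub>M\<^esub> B \<star>\<^bsub>M\<^esub> G)"
    using T.core_EP_inverse_from_Drazin[OF D assms(3), of G, unfolded pow] G by (simp add: B_def)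
  have "core_EP_inverse M A = (THE X. T.is_core_EP_inverse k A X)"
    by (simp only: core_EP_inverse_def T.is_core_EP_inverse_def pow assms(2))
  also have "\<dots> = D \<star>\<^bsub>M\<^esub> B \<star>\<^bsub>M\<^esub> G"
    using C T.core_EP_inverse_unique by blast
  finally show ?thesis
    using D_eq G_eq by (simp add: B_def)
qed

end
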